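(* Let $\mathcal A$ and $\mathfrak A$ be Banach algebras such that $\mathcal A$ is a Banach $\mathfrak A$-bimodule with compatible actions. A continuous linear map $D:\mathcal A\rtimes\mathfrak A\to(\mathcal A\rtimes\mathfrak A)^{(1)}$ is a cyclic derivation if and only if there exist cyclic derivations $D^1_{\mathcal A}:\mathcal A\to\mathcal A^{(1)}$ and $D^2_{\mathfrak A}:\mathfrak A\to\mathfrak A^{(1)}$, a derivation $D^1_{\mathfrak A}:\mathfrak A\to\mathcal A^{(1)}$ and a bounded linear map $D^2_{\mathcal A}:\mathcal A\to\mathfrak A^{(1)}$ such that for all $a,b\in\mathcal A$ and $\beta\in\mathfrak A$: (i) $D((a,\beta))=(D^1_{\mathcal A}(a)+D^1_{\mathfrak A}(\beta),\ D^2_{\mathcal A}(a)+D^2_{\mathfrak A}(\beta))$; (ii) $D^1_{\mathcal A}(\beta\cdot a)=D^1_{\mathfrak A}(\beta)\circ a+\beta\blacktriangle D^1_{\mathcal A}(a)$ and $D^1_{\mathcal A}(a\cdot\beta)=a\vartriangle D^1_{\mathfrak A}(\beta)+D^1_{\mathcal A}(a)\bullet\beta$; (iii) $D^2_{\mathcal A}(\beta\cdot a)=D^1_{\mathfrak A}(\beta)\bullet a+\beta\vartriangle D^2_{\mathcal A}(a)$ and $D^2_{\mathcal A}(a\cdot\beta)=a\blacktriangle D^1_{\mathfrak A}(\beta)+D^2_{\mathcal A}(a)\circ\beta$; (iv) $D^2_{\mathcal A}(ab)=D^1_{\mathcal A}(a)\bullet b+a\blacktriangle D^1_{\mathcal A}(b)$;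 (v) $(D^2_{\mathcal A})^*\circ\Phi+D^1_{\mathfrak A}=0$ (composition of maps), where $\Phi:\mathfrak A\to\mathfrak A^{(2)}$ is the canonical injection and $(D^2_{\mathcal A})^*:\mathfrak A^{(2)}\to\mathcal A^{(1)}$ is the adjoint of $D^2_{\mathcal A}$.
   Context: The actions of $\mathfrak A$ on $\mathcal A$ are compatible if for all $a,b\in\mathcal A$ and $\beta\in\mathfrak A$: $\beta\cdot(ab)=(\beta\cdot a)b$, $(ab)\cdot\beta=a(b\cdot\beta)$, $a(\beta\cdot b)=(a\cdot\beta)b$. The amalgamated duplication $\mathcal A\rtimes\mathfrak A$ is $\mathcal A\times\mathfrak A$ with product $(a,\beta)(b,\gamma)=(ab+a\cdot\gamma+\beta\cdot b,\ \beta\gamma)$ and norm $\|(a,\beta)\|=\|a\|+\|\beta\|$. $\mathcal Y^{(k)}$ is the $k$-th dual of $\mathcal Y$; $(\mathcal A\rtimes\mathfrak A)^{(1)}$ is identified with $\mathcal A^{(1)}\times\mathfrak A^{(1)}$ via $\langle(a^{(1)},\beta^{(1)}),(a,\beta)\rangle=\langle a^{(1)},a\rangle+\langle\beta^{(1)},\beta\rangle$. Notation, for $a,b\in\mathcal A$, $\beta,\gamma\in\mathfrak A$, $x\in\mathcal A^{(1)}$, $y\in\mathfrak A^{(1)}$: $a\vartriangle x,\ x\circ a\in\mathcal A^{(1)}$ with $\langle a\vartriangle x,b\rangle=\langle x,ba\rangle$, $\langle x\circ a,b\rangle=\langle x,ab\rangle$; $\beta\vartriangle y,\ y\circ\beta\in\mathfrak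 A^{(1)}$ with $\langle\beta\vartriangle y,\gamma\rangle=\langle y,\gamma\beta\rangle$, $\langle y\circ\beta,\gamma\rangle=\langle y,\beta\gamma\rangle$; $\beta\blacktriangle x,\ x\bullet\beta\in\mathcal A^{(1)}$ with $\langle\beta\blacktriangle x,b\rangle=\langle x,b\cdot\beta\rangle$, $\langle x\bullet\beta,b\rangle=\langle x,\beta\cdot b\rangle$; $a\blacktriangle x,\ x\bullet a\in\mathfrak A^{(1)}$ with $\langle a\blacktriangle x,\gamma\rangle=\langle x,\gamma\cdot a\rangle$, $\langle x\bullet a,\gamma\rangle=\langle x,a\cdot\gamma\rangle$. A derivation from a Banach algebra $\mathcal C$ into a Banach $\mathcal C$-bimodule $\mathcal X$ is a continuous linear map $D$ with $D(c_1c_2)=D(c_1)\cdot c_2+c_1\cdot D(c_2)$; duals carry the usual dual bimodule structure ($\langle f\cdot c,x\rangle=\langle f,c\cdot x\rangle$, $\langle c\cdot f,x\rangle=\langle f,x\cdot c\rangle$), and $\mathcal A^{(1)}$ is an $\mathfrak A$-bimodule as dual of the $\mathfrak A$-bimodule $\mathcal A$. A derivation $D:\mathcal C\to\mathcal C^{(1)}$ is cyclic if $\langle D(c_1),c_2\rangle+\langle D(c_2),c_1\rangle=0$ for all $c_1,c_2\in\mathcal C$. *)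

theory Defs
  imports "HOL-Analysis.Analysis"
begin

section \<open>Complex Banach spaces and algebras\<close>

text \<open>
  Scalars are complex.  HOL-Analysis only has normed spaces and algebras over the reals, so the
  complex structure is added on top of the real type classes, with real scaling being the
  restriction of complex scaling.
\<close>

class scaleC = scaleR +
  fixes scaleC :: "complex \<Rightarrow> 'a \<Rightarrow> 'a" (infixr \<open>*\<^sub>C\<close> 75)
  assumes scaleR_scaleC: "scaleR r x = scaleC (complex_of_real r) x"

class complex_normed_vector = scaleC + real_normed_vector +
  assumes scaleC_add_right: "c *\<^sub>C (x + y) = c *\<^sub>C x + c *\<^sub>C y"
    and scaleC_add_left: "(c + d) *\<^sub>C x = c *\<^sub>C x + d *\<^sub>C x"
    and scaleC_scaleC: "c *\<^sub>C d *\<^sub>C x = (c * d) *\<^sub>C x"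
    and scaleC_one: "1 *\<^sub>C x = x"
    and norm_scaleC: "norm (c *\<^sub>C x) = cmod c * norm x"

class cbanach = complex_normed_vector + banach

text \<open>
  Banach algebras are not assumed to be unital.
\<close>

class cbanach_algebra = cbanach + real_normed_algebra +
  assumes mult_scaleC_left: "(c *\<^sub>C x) * y = c *\<^sub>C (x * y)"
    and mult_scaleC_right: "x * (c *\<^sub>C y) = c *\<^sub>C (x * y)"

instantiation complex :: cbanach_algebra
begin

definition scaleC_complex :: "complex \<Rightarrow> complex \<Rightarrow> complex"
  where "scaleC_complex c x = c * x"

instance
  by standard (auto simp: scaleC_complex_def scaleR_conv_of_real algebra_simps norm_mult)

end

definition bounded_clinear :: "('x::complex_normed_vector \<Rightarrow> 'y::complex_normed_vector) \<Rightarrow> bool"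
  where "bounded_clinear f \<longleftrightarrow> bounded_linear f \<and> (\<forall>c x. f (c *\<^sub>C x) = c *\<^sub>C f x)"

definition bounded_cbilinear ::
    "('x::complex_normed_vector \<Rightarrow> 'y::complex_normed_vector \<Rightarrow> 'z::complex_normed_vector) \<Rightarrow> bool"
  where "bounded_cbilinear p \<longleftrightarrow> bounded_bilinear p \<and>
    (\<forall>c x y. p (c *\<^sub>C x) y = c *\<^sub>C p x y \<and> p x (c *\<^sub>C y) = c *\<^sub>C p x y)"

lemma bounded_clinear_left:
  "bounded_cbilinear p \<Longrightarrow> bounded_clinear (\<lambda>x. p x y)"
  by (auto simp: bounded_cbilinear_def bounded_clinear_def bounded_bilinear.bounded_linear_left)

lemma bounded_clinear_right:
  "bounded_cbilinear p \<Longrightarrow> bounded_clinear (\<lambda>y. p x y)"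
  by (auto simp: bounded_cbilinear_def bounded_clinear_def bounded_bilinear.bounded_linear_right)

lemma bounded_clinear_compose:
  "bounded_clinear f \<Longrightarrow> bounded_clinear g \<Longrightarrow> bounded_clinear (\<lambda>x. f (g x))"
  by (auto simp: bounded_clinear_def bounded_linear_compose)

lemma bounded_clinear_add:
  "bounded_clinear f \<Longrightarrow> bounded_clinear g \<Longrightarrow> bounded_clinear (\<lambda>x. f x + g x)"
  by (auto simp: bounded_clinear_def bounded_linear_add scaleC_add_right)

lemma bounded_cbilinear_mult:
  "bounded_cbilinear ((*) :: 'a::cbanach_algebra \<Rightarrow> 'a \<Rightarrow> 'a)"
  by (auto simp: bounded_cbilinear_def bounded_bilinear_mult mult_scaleC_left mult_scaleC_right)


section \<open>Dual spaces\<close>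

typedef (overloaded) 'x cdual = "{f :: 'x::complex_normed_vector \<Rightarrow> complex. bounded_clinear f}"
  morphisms cdual_apply CDual
  by (rule exI[of _ "\<lambda>_. 0"]) (auto simp: bounded_clinear_def scaleC_complex_def)

setup_lifting type_definition_cdual

lemma cdual_apply_CDual: "bounded_clinear f \<Longrightarrow> cdual_apply (CDual f) = f"
  by (simp add: CDual_inverse)

lemma bounded_clinear_cdual_apply: "bounded_clinear (cdual_apply f)"
  using cdual_apply[of f] by simp

lemma cdual_eqI: "(\<And>x. cdual_apply f x = cdual_apply g x) \<Longrightarrow> f = g"
  by (simp add: cdual_apply_inject[symmetric] fun_eq_iff)

instantiation cdual :: (complex_normed_vector) complex_normed_vector
begin

lift_definition norm_cdual :: "'a cdual \<Rightarrow> real" is onorm .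

lift_definition minus_cdual :: "'a cdual \<Rightarrow> 'a cdual \<Rightarrow> 'a cdual" is "\<lambda>f g x. f x - g x"
  by (auto simp: bounded_clinear_def bounded_linear_sub scaleC_complex_def algebra_simps)

lift_definition plus_cdual :: "'a cdual \<Rightarrow> 'a cdual \<Rightarrow> 'a cdual" is "\<lambda>f g x. f x + g x"
  by (rule bounded_clinear_add)

lift_definition uminus_cdual :: "'a cdual \<Rightarrow> 'a cdual" is "\<lambda>f x. - f x"
  by (auto simp: bounded_clinear_def bounded_linear_minus scaleC_complex_def)

lift_definition zero_cdual :: "'a cdual" is "\<lambda>x. 0"
  by (auto simp: bounded_clinear_def scaleC_complex_def)

lift_definition scaleC_cdual :: "complex \<Rightarrow> 'a cdual \<Rightarrow> 'a cdual" is "\<lambda>c f x. c * f x"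
  by (auto simp: bounded_clinear_def bounded_linear_mult_right
      bounded_linear_const_mult scaleC_complex_def)

definition scaleR_cdual :: "real \<Rightarrow> 'a cdual \<Rightarrow> 'a cdual"
  where "scaleR_cdual r f = complex_of_real r *\<^sub>C f"

definition dist_cdual :: "'a cdual \<Rightarrow> 'a cdual \<Rightarrow> real"
  where "dist_cdual f g = norm (f - g)"

definition [code del]:
  "(uniformity :: ('a cdual \<times> 'a cdual) filter) =
    (INF e\<in>{0 <..}. principal {(x, y). dist x y < e})"

definition open_cdual :: "'a cdual set \<Rightarrow> bool"
  where [code del]: "open_cdual S = (\<forall>x\<in>S. \<forall>\<^sub>F (x', y) in uniformity. x' = x \<longrightarrow> y \<in> S)"

definition sgn_cdual :: "'a cdual \<Rightarrow> 'a cdual"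
  where "sgn_cdual f = scaleR (inverse (norm f)) f"

instance
proof
  have norm_C: "norm (c *\<^sub>C f) = cmod c * norm f" for c and f :: "'a cdual"
  proof transfer
    fix c and f :: "'a \<Rightarrow> complex" assume f: "bounded_clinear f"
    show "onorm (\<lambda>x. c * f x) = cmod c * onorm f"
    proof (cases "c = 0")
      case False
      have bl: "bounded_linear f" using f by (simp add: bounded_clinear_def)
      have le: "onorm (\<lambda>x. d * g x) \<le> cmod d * onorm g" if g: "bounded_linear g"
        for d and g :: "'a \<Rightarrow> complex"
        by (rule onorm_bound)
          (auto simp: norm_mult mult.assoc onorm_pos_le[OF g] intro!: mult_left_mono onorm[OF g])
      have "onorm (\<lambda>x. inverse c * (c * f x)) \<le> cmod (inverse c) * onorm (\<lambda>x. c * f x)"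
        by (rule le) (rule bounded_linear_const_mult[OF bl])
      then have "onorm f \<le> inverse (cmod c) * onorm (\<lambda>x. c * f x)"
        using False by (simp add: norm_inverse flip: mult.assoc)
      then have "cmod c * onorm f \<le> onorm (\<lambda>x. c * f x)"
        using False by (simp add: field_simps)
      with le[OF bl, of c] show ?thesis by simp
    qed (simp add: onorm_zero)
  qed
  fix c d :: complex and r s :: real and f g h :: "'a cdual" and S :: "'a cdual set"
  show "f + g + h = f + (g + h)" "0 + f = f" "f + g = g + f" "- f + f = 0" "f - g = f + - g"
    by (transfer; simp add: fun_eq_iff)+
  show C: "c *\<^sub>C (f + g) = c *\<^sub>C f + c *\<^sub>C g" "(c + d) *\<^sub>C f = c *\<^sub>C f + d *\<^sub>C f"
    "c *\<^sub>C d *\<^sub>C f = (c * d) *\<^sub>C f" "1 *\<^sub>C f = f"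
    by (transfer; simp add: fun_eq_iff algebra_simps)+
  show "r *\<^sub>R f = complex_of_real r *\<^sub>C f" by (simp add: scaleR_cdual_def)
  show "r *\<^sub>R (f + g) = r *\<^sub>R f + r *\<^sub>R g" "(r + s) *\<^sub>R f = r *\<^sub>R f + s *\<^sub>R f"
    "r *\<^sub>R s *\<^sub>R f = (r * s) *\<^sub>R f" "1 *\<^sub>R f = f"
    unfolding scaleR_cdual_def by (transfer; simp add: fun_eq_iff algebra_simps)+
  show "norm (c *\<^sub>C f) = cmod c * norm f" by (rule norm_C)
  show "norm (r *\<^sub>R f) = \<bar>r\<bar> * norm f" by (simp add: scaleR_cdual_def norm_C)
  show "norm f = 0 \<longleftrightarrow> f = 0"
    by transfer (auto simp: bounded_clinear_def onorm_eq_0)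
  show "norm (f + g) \<le> norm f + norm g"
    by transfer (auto simp: bounded_clinear_def intro: onorm_triangle)
  show "sgn f = inverse (norm f) *\<^sub>R f" by (rule sgn_cdual_def)
  show "dist f g = norm (f - g)" by (rule dist_cdual_def)
  show "(uniformity :: ('a cdual \<times> 'a cdual) filter) =
    (INF e\<in>{0 <..}. principal {(x, y). dist x y < e})" by (rule uniformity_cdual_def)
  show "open S = (\<forall>x\<in>S. \<forall>\<^sub>F (x', y) in uniformity. x' = x \<longrightarrow> y \<in> S)"
    by (rule open_cdual_def)
qed

end

lemma cdual_apply_simps [simp]:
  "cdual_apply 0 x = 0"
  "cdual_apply (f + g) x = cdual_apply f x + cdual_apply g x"
  "cdual_apply (f - g) x = cdual_apply f x - cdual_apply g x"
  "cdual_apply (- f) x = - cdual_apply f x"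
  "cdual_apply (c *\<^sub>C f) x = c * cdual_apply f x"
  by (transfer; simp)+

lemma cdual_apply_scaleR [simp]: "cdual_apply (r *\<^sub>R f) x = r *\<^sub>R cdual_apply f x"
  by (simp add: scaleR_cdual_def scaleR_conv_of_real)

lemma norm_cdual_apply: "norm (cdual_apply f x) \<le> norm f * norm x"
  by transfer (auto simp: bounded_clinear_def intro: onorm)

lemma norm_cdual_bound:
  "0 \<le> b \<Longrightarrow> (\<And>x. norm (cdual_apply f x) \<le> b * norm x) \<Longrightarrow> norm f \<le> b"
  by transfer (rule onorm_bound)

lemma bounded_cbilinear_cdual_apply: "bounded_cbilinear cdual_apply"
proof -
  have lin: "bounded_linear (cdual_apply f)" for f :: "'a cdual"
    using bounded_clinear_cdual_apply[of f] by (simp add: bounded_clinear_def)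
  have "bounded_bilinear (cdual_apply :: 'a cdual \<Rightarrow> _)"
    by standard (auto simp: linear_simps[OF lin] norm_cdual_apply intro!: exI[of _ 1])
  then show ?thesis
    using bounded_clinear_cdual_apply
    by (auto simp: bounded_cbilinear_def bounded_clinear_def scaleC_complex_def)
qed

instance cdual :: (complex_normed_vector) cbanach
proof
  fix X :: "nat \<Rightarrow> 'a cdual" assume X: "Cauchy X"
  define Y where "Y n = Blinfun (cdual_apply (X n))" for n
  have lin: "bounded_linear (cdual_apply f)" for f :: "'a cdual"
    using bounded_clinear_cdual_apply[of f] by (simp add: bounded_clinear_def)
  have Y: "blinfun_apply (Y n) = cdual_apply (X n)" for n
    by (simp add: Y_def bounded_linear_Blinfun_apply[OF lin])
  have "dist (Y m) (Y n) = dist (X m) (X n)" for m n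
    by (simp add: dist_norm norm_blinfun.rep_eq norm_cdual.rep_eq minus_blinfun.rep_eq
        minus_cdual.rep_eq Y)
  with X have "Cauchy Y" by (simp add: Cauchy_def)
  then obtain L where L: "Y \<longlonglongrightarrow> L" unfolding Cauchy_convergent_iff convergent_def by blast
  have lim: "(\<lambda>n. cdual_apply (X n) x) \<longlonglongrightarrow> blinfun_apply L x" for x
    using blinfun.tendsto[OF L tendsto_const[of x]] by (simp add: Y)
  have hom: "blinfun_apply L (c *\<^sub>C x) = c * blinfun_apply L x" for c x
  proof (rule LIMSEQ_unique[OF lim])
    have "cdual_apply (X n) (c *\<^sub>C x) = c * cdual_apply (X n) x" for n
      using bounded_clinear_cdual_apply[of "X n"]
      by (simp add: bounded_clinear_def scaleC_complex_def)
    then show "(\<lambda>n. cdual_apply (X n) (c *\<^sub>C x)) \<longlonglongrightarrow> c * blinfun_apply L x"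
      using tendsto_mult[OF tendsto_const lim] by simp
  qed
  have bcl: "bounded_clinear (blinfun_apply L)"
    by (simp add: bounded_clinear_def hom scaleC_complex_def blinfun.bounded_linear_right)
  have "dist (X n) (CDual (blinfun_apply L)) = dist (Y n) L" for n
    by (simp add: dist_norm norm_blinfun.rep_eq norm_cdual.rep_eq minus_blinfun.rep_eq
        minus_cdual.rep_eq Y cdual_apply_CDual[OF bcl])
  moreover from L have "(\<lambda>n. dist (Y n) L) \<longlonglongrightarrow> 0" by (rule tendsto_dist_iff[THEN iffD1])
  ultimately have "X \<longlonglongrightarrow> CDual (blinfun_apply L)" by (subst tendsto_dist_iff) simp
  then show "convergent X" by (auto simp: convergent_def)
qed

definition canonical_injection :: "'x::complex_normed_vector \<Rightarrow> 'x cdual cdual"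
  where "canonical_injection x = CDual (\<lambda>f. cdual_apply f x)"

definition cadjoint ::
    "('x::complex_normed_vector \<Rightarrow> 'y::complex_normed_vector) \<Rightarrow> 'y cdual \<Rightarrow> 'x cdual"
  where "cadjoint T f = CDual (\<lambda>x. cdual_apply f (T x))"

lemma canonical_injection_apply:
  "cdual_apply (canonical_injection x) f = cdual_apply f x"
  unfolding canonical_injection_def
  by (simp add: cdual_apply_CDual bounded_clinear_left[OF bounded_cbilinear_cdual_apply])

lemma cadjoint_apply:
  "bounded_clinear T \<Longrightarrow> cdual_apply (cadjoint T f) x = cdual_apply f (T x)"
  unfolding cadjoint_def
  by (simp add: cdual_apply_CDual bounded_clinear_compose[OF bounded_clinear_cdual_apply])


section \<open>Bimodules and derivations\<close>

text \<open>
  The product \<open>m\<close> of the acting algebra is an explicit argument, because the product of the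
  amalgamated duplication depends on the two actions.
  The actions are required to be jointly continuous, but not contractive.
\<close>

definition banach_bimodule ::
    "('c::cbanach \<Rightarrow> 'c \<Rightarrow> 'c) \<Rightarrow> ('c \<Rightarrow> 'x::cbanach \<Rightarrow> 'x) \<Rightarrow> ('x \<Rightarrow> 'c \<Rightarrow> 'x) \<Rightarrow> bool"
  where "banach_bimodule m l r \<longleftrightarrow>
    bounded_cbilinear l \<and> bounded_cbilinear r \<and>
    (\<forall>c d x. l (m c d) x = l c (l d x)) \<and>
    (\<forall>c d x. r x (m c d) = r (r x c) d) \<and>
    (\<forall>c d x. r (l c x) d = l c (r x d))"

text \<open>
  Transposes of a bounded bilinear map \<open>p\<close>.
  All operations on duals are instances: for the product \<open>p\<close> of a Banach algebra \<open>dual_left p c f\<close>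
  is \<open>c \<triangle> f\<close> and \<open>dual_right p f c\<close> is \<open>f \<circ> c\<close>; for the two actions \<open>l\<close>, \<open>r\<close> on
  \<open>x\<close> in the dual of the module, \<open>dual_left r \<beta> x\<close> and \<open>dual_right l x \<beta>\<close> are the filled triangle
  and bullet with an algebra element \<open>\<beta>\<close>, and \<open>dual_left l a x\<close> and \<open>dual_right r x a\<close> are those with
  a module element \<open>a\<close>.  The dual of a bimodule with actions \<open>l\<close>, \<open>r\<close> has left action
  \<open>dual_left r\<close> and right action \<open>dual_right l\<close>.
\<close>

definition dual_left ::
    "('x::complex_normed_vector \<Rightarrow> 'c \<Rightarrow> 'z::complex_normed_vector) \<Rightarrow> 'c \<Rightarrow> 'z cdual \<Rightarrow> 'x cdual"
  where "dual_left p c f = CDual (\<lambda>x. cdual_apply f (p x c))"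

definition dual_right ::
    "('c \<Rightarrow> 'x::complex_normed_vector \<Rightarrow> 'z::complex_normed_vector) \<Rightarrow> 'z cdual \<Rightarrow> 'c \<Rightarrow> 'x cdual"
  where "dual_right p f c = CDual (\<lambda>x. cdual_apply f (p c x))"

lemma dual_left_apply:
  "bounded_cbilinear p \<Longrightarrow> cdual_apply (dual_left p c f) x = cdual_apply f (p x c)"
  unfolding dual_left_def
  by (simp add: cdual_apply_CDual bounded_clinear_left
      bounded_clinear_compose[OF bounded_clinear_cdual_apply])

lemma dual_right_apply:
  "bounded_cbilinear p \<Longrightarrow> cdual_apply (dual_right p f c) x = cdual_apply f (p c x)"
  unfolding dual_right_def
  by (simp add: cdual_apply_CDual bounded_clinear_right
      bounded_clinear_compose[OF bounded_clinear_cdual_apply])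

lemma banach_bimodule_dual:
  assumes "banach_bimodule m l r"
  shows "banach_bimodule m (dual_left r) (dual_right l)"
proof -
  have L: "bounded_cbilinear l" and R: "bounded_cbilinear r"
    using assms by (auto simp: banach_bimodule_def)
  note ap = dual_left_apply[OF R] dual_right_apply[OF L]
  have l: "bounded_bilinear l" and r: "bounded_bilinear r"
    using L R by (auto simp: bounded_cbilinear_def)
  have lin: "bounded_linear (cdual_apply f)" for f :: "'b cdual"
    using bounded_clinear_cdual_apply[of f] by (simp add: bounded_clinear_def)
  have C: "cdual_apply f (c *\<^sub>C x) = c * cdual_apply f x" for f :: "'b cdual" and c x
    using bounded_clinear_cdual_apply[of f] by (simp add: bounded_clinear_def scaleC_complex_def)
  note sm = ap linear_simps[OF lin] C
      bounded_bilinear.add_left[OF l] bounded_bilinear.add_right[OF l]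
      bounded_bilinear.add_left[OF r] bounded_bilinear.add_right[OF r]
      bounded_bilinear.scaleR_left[OF l] bounded_bilinear.scaleR_right[OF l]
      bounded_bilinear.scaleR_left[OF r] bounded_bilinear.scaleR_right[OF r]
  obtain K where K: "\<And>c x. norm (l c x) \<le> norm c * norm x * K" "K \<ge> 0"
    using bounded_bilinear.nonneg_bounded[OF l] by blast
  obtain M where M: "\<And>x c. norm (r x c) \<le> norm x * norm c * M" "M \<ge> 0"
    using bounded_bilinear.nonneg_bounded[OF r] by blast
  have 1: "norm (dual_left r c f) \<le> norm c * norm f * M" for c f
  proof (rule norm_cdual_bound)
    fix x
    have "norm (cdual_apply f (r x c)) \<le> norm f * (norm x * norm c * M)"
      using norm_cdual_apply[of f "r x c"] mult_left_mono[OF M(1)[of x c], of "norm f"] by simp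
    then show "norm (cdual_apply (dual_left r c f) x) \<le> norm c * norm f * M * norm x"
      by (simp add: ap ac_simps)
  qed (use M in simp)
  have 2: "norm (dual_right l f c) \<le> norm f * norm c * K" for c f
  proof (rule norm_cdual_bound)
    fix x
    have "norm (cdual_apply f (l c x)) \<le> norm f * (norm c * norm x * K)"
      using norm_cdual_apply[of f "l c x"] mult_left_mono[OF K(1)[of c x], of "norm f"] by simp
    then show "norm (cdual_apply (dual_right l f c) x) \<le> norm f * norm c * K * norm x"
      by (simp add: ap ac_simps)
  qed (use K in simp)
  have "bounded_bilinear (dual_left r)"
    by standard (auto intro!: cdual_eqI exI[of _ M] 1 simp: sm)
  moreover have "bounded_bilinear (dual_right l)"
    by standard (auto intro!: cdual_eqI exI[of _ K] 2 simp: sm)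
  ultimately show ?thesis using assms
    by (auto simp: banach_bimodule_def bounded_cbilinear_def ap C intro!: cdual_eqI)
qed

definition derivation ::
    "('c::cbanach \<Rightarrow> 'c \<Rightarrow> 'c) \<Rightarrow> ('c \<Rightarrow> 'x::cbanach \<Rightarrow> 'x) \<Rightarrow> ('x \<Rightarrow> 'c \<Rightarrow> 'x) \<Rightarrow> ('c \<Rightarrow> 'x) \<Rightarrow> bool"
  where "derivation m l r D \<longleftrightarrow>
    bounded_clinear D \<and> (\<forall>c1 c2. D (m c1 c2) = r (D c1) c2 + l c1 (D c2))"

definition cyclic_derivation ::
    "('c::cbanach \<Rightarrow> 'c \<Rightarrow> 'c) \<Rightarrow> ('c \<Rightarrow> 'c cdual) \<Rightarrow> bool"
  where "cyclic_derivation m D \<longleftrightarrow>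
    derivation m (dual_left m) (dual_right m) D \<and>
    (\<forall>c1 c2. cdual_apply (D c1) c2 + cdual_apply (D c2) c1 = 0)"


section \<open>The amalgamated duplication\<close>

definition compatible_actions ::
    "('b::cbanach_algebra \<Rightarrow> 'a::cbanach_algebra \<Rightarrow> 'a) \<Rightarrow> ('a \<Rightarrow> 'b \<Rightarrow> 'a) \<Rightarrow> bool"
  where "compatible_actions l r \<longleftrightarrow>
    (\<forall>a b \<beta>. l \<beta> (a * b) = l \<beta> a * b \<and> r (a * b) \<beta> = a * r b \<beta> \<and> a * l \<beta> b = r a \<beta> * b)"

text \<open>
  A separate type is used, since the library norm on pairs is the Euclidean combination of the two
  norms and not their sum.
\<close>

datatype ('a, 'b) dup = Dup (dup_fst: 'a) (dup_snd: 'b)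

instantiation dup :: (complex_normed_vector, complex_normed_vector) complex_normed_vector
begin

definition "p + q = Dup (dup_fst p + dup_fst q) (dup_snd p + dup_snd q)"
definition "p - q = Dup (dup_fst p - dup_fst q) (dup_snd p - dup_snd q)"
definition "- p = Dup (- dup_fst p) (- dup_snd p)"
definition "0 = Dup 0 0"
definition "c *\<^sub>C p = Dup (c *\<^sub>C dup_fst p) (c *\<^sub>C dup_snd p)"
definition "r *\<^sub>R p = Dup (r *\<^sub>R dup_fst p) (r *\<^sub>R dup_snd p)"
definition "norm p = norm (dup_fst p) + norm (dup_snd p)"
definition "sgn (p :: ('a, 'b) dup) = inverse (norm p) *\<^sub>R p"
definition "dist (p :: ('a, 'b) dup) q = norm (p - q)"

definition [code del]:
  "(uniformity :: (('a, 'b) dup \<times> ('a, 'b) dup) filter) =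
    (INF e\<in>{0 <..}. principal {(x, y). dist x y < e})"

definition open_dup :: "('a, 'b) dup set \<Rightarrow> bool"
  where [code del]: "open_dup S = (\<forall>x\<in>S. \<forall>\<^sub>F (x', y) in uniformity. x' = x \<longrightarrow> y \<in> S)"

instance
proof
  fix c d :: complex and r s :: real and p q t :: "('a, 'b) dup" and S :: "('a, 'b) dup set"
  note defs = plus_dup_def minus_dup_def uminus_dup_def zero_dup_def scaleC_dup_def
    scaleR_dup_def norm_dup_def
  show "p + q + t = p + (q + t)" "0 + p = p" "p + q = q + p" "- p + p = 0" "p - q = p + - q"
    by (simp_all add: defs algebra_simps)
  show "c *\<^sub>C (p + q) = c *\<^sub>C p + c *\<^sub>C q" "(c + d) *\<^sub>C p = c *\<^sub>C p + d *\<^sub>C p"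
    "c *\<^sub>C d *\<^sub>C p = (c * d) *\<^sub>C p" "1 *\<^sub>C p = p" "norm (c *\<^sub>C p) = cmod c * norm p"
    by (simp_all add: defs scaleC_add_left scaleC_add_right scaleC_scaleC scaleC_one norm_scaleC
        distrib_left)
  show "r *\<^sub>R p = complex_of_real r *\<^sub>C p" by (simp add: defs scaleR_scaleC)
  show "r *\<^sub>R (p + q) = r *\<^sub>R p + r *\<^sub>R q" "(r + s) *\<^sub>R p = r *\<^sub>R p + s *\<^sub>R p"
    "r *\<^sub>R s *\<^sub>R p = (r * s) *\<^sub>R p" "1 *\<^sub>R p = p" "norm (r *\<^sub>R p) = \<bar>r\<bar> * norm p"
    by (simp_all add: defs algebra_simps)
  show "norm p = 0 \<longleftrightarrow> p = 0"
    by (cases p) (auto simp: defs add_nonneg_eq_0_iff)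
  show "norm (p + q) \<le> norm p + norm q"
    using norm_triangle_ineq[of "dup_fst p" "dup_fst q"]
      norm_triangle_ineq[of "dup_snd p" "dup_snd q"] by (simp add: defs)
  show "sgn p = inverse (norm p) *\<^sub>R p" by (rule sgn_dup_def)
  show "dist p q = norm (p - q)" by (rule dist_dup_def)
  show "(uniformity :: (('a, 'b) dup \<times> ('a, 'b) dup) filter) =
    (INF e\<in>{0 <..}. principal {(x, y). dist x y < e})" by (rule uniformity_dup_def)
  show "open S = (\<forall>x\<in>S. \<forall>\<^sub>F (x', y) in uniformity. x' = x \<longrightarrow> y \<in> S)"
    by (rule open_dup_def)
qed

end

lemma dup_simps [simp]:
  "dup_fst (p + q) = dup_fst p + dup_fst q" "dup_snd (p + q) = dup_snd p + dup_snd q"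
  "dup_fst (p - q) = dup_fst p - dup_fst q" "dup_snd (p - q) = dup_snd p - dup_snd q"
  "dup_fst (- p) = - dup_fst p" "dup_snd (- p) = - dup_snd p"
  "dup_fst 0 = 0" "dup_snd 0 = 0"
  "dup_fst (c *\<^sub>C p) = c *\<^sub>C dup_fst p" "dup_snd (c *\<^sub>C p) = c *\<^sub>C dup_snd p"
  "dup_fst (r *\<^sub>R p) = r *\<^sub>R dup_fst p" "dup_snd (r *\<^sub>R p) = r *\<^sub>R dup_snd p"
  by (simp_all add: plus_dup_def minus_dup_def uminus_dup_def zero_dup_def scaleC_dup_def
      scaleR_dup_def)

lemma bounded_clinear_dup_fst:
  "bounded_clinear (dup_fst :: ('a::complex_normed_vector, 'b::complex_normed_vector) dup \<Rightarrow> 'a)"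
proof -
  have "bounded_linear (dup_fst :: ('a, 'b) dup \<Rightarrow> 'a)"
    by (rule bounded_linear_intro[where K = 1]) (auto simp: norm_dup_def)
  then show ?thesis by (simp add: bounded_clinear_def)
qed

lemma bounded_clinear_dup_snd:
  "bounded_clinear (dup_snd :: ('a::complex_normed_vector, 'b::complex_normed_vector) dup \<Rightarrow> 'b)"
proof -
  have "bounded_linear (dup_snd :: ('a, 'b) dup \<Rightarrow> 'b)"
    by (rule bounded_linear_intro[where K = 1]) (auto simp: norm_dup_def)
  then show ?thesis by (simp add: bounded_clinear_def)
qed

instance dup :: (cbanach, cbanach) cbanach
proof
  fix X :: "nat \<Rightarrow> ('a, 'b) dup" assume X: "Cauchy X"
  have "Cauchy (\<lambda>n. dup_fst (X n))" "Cauchy (\<lambda>n. dup_snd (X n))"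
    using bounded_clinear_dup_fst bounded_clinear_dup_snd X
    by (auto simp: bounded_clinear_def intro: bounded_linear.Cauchy)
  then obtain a b where "(\<lambda>n. dup_fst (X n)) \<longlonglongrightarrow> a" "(\<lambda>n. dup_snd (X n)) \<longlonglongrightarrow> b"
    by (auto dest!: Cauchy_convergent simp: convergent_def)
  then have "(\<lambda>n. dist (dup_fst (X n)) a + dist (dup_snd (X n)) b) \<longlonglongrightarrow> 0 + 0"
    by (intro tendsto_add tendsto_dist_iff[THEN iffD1])
  moreover have "dist p (Dup a b) = dist (dup_fst p) a + dist (dup_snd p) b" for p
    by (simp add: dist_norm norm_dup_def)
  ultimately have "X \<longlonglongrightarrow> Dup a b" by (subst tendsto_dist_iff) simp
  then show "convergent X" by (auto simp: convergent_def)
qed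

definition dup_mult ::
    "('b::cbanach_algebra \<Rightarrow> 'a::cbanach_algebra \<Rightarrow> 'a) \<Rightarrow> ('a \<Rightarrow> 'b \<Rightarrow> 'a) \<Rightarrow>
      ('a, 'b) dup \<Rightarrow> ('a, 'b) dup \<Rightarrow> ('a, 'b) dup"
  where "dup_mult l r p q =
    Dup (dup_fst p * dup_fst q + r (dup_fst p) (dup_snd q) + l (dup_snd p) (dup_fst q))
        (dup_snd p * dup_snd q)"

definition dup_functional ::
    "'a::complex_normed_vector cdual \<Rightarrow> 'b::complex_normed_vector cdual \<Rightarrow> ('a, 'b) dup cdual"
  where "dup_functional x y = CDual (\<lambda>p. cdual_apply x (dup_fst p) + cdual_apply y (dup_snd p))"

lemma dup_functional_apply:
  "cdual_apply (dup_functional x y) (Dup a \<beta>) = cdual_apply x a + cdual_apply y \<beta>"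
  unfolding dup_functional_def
  by (subst cdual_apply_CDual)
    (auto intro!: bounded_clinear_add bounded_clinear_compose[OF bounded_clinear_cdual_apply]
      bounded_clinear_dup_fst bounded_clinear_dup_snd)

lemma dup_mult_assoc:
  assumes "banach_bimodule (*) l r" "compatible_actions l r"
  shows "dup_mult l r (dup_mult l r p q) t = dup_mult l r p (dup_mult l r q t)"
proof -
  have l: "bounded_bilinear l" and r: "bounded_bilinear r"
    using assms by (auto simp: banach_bimodule_def bounded_cbilinear_def)
  show ?thesis
    using assms unfolding banach_bimodule_def compatible_actions_def dup_mult_def
    by (simp add: bounded_bilinear.add_left[OF l] bounded_bilinear.add_right[OF l]
        bounded_bilinear.add_left[OF r] bounded_bilinear.add_right[OF r] algebra_simps)
qed

lemma bounded_cbilinear_dup_mult: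
  assumes "banach_bimodule (*) l r"
  shows "bounded_cbilinear (dup_mult l r)"
proof -
  have l: "bounded_bilinear l" and r: "bounded_bilinear r"
    and lC: "l (c *\<^sub>C \<beta>) a = c *\<^sub>C l \<beta> a" "l \<beta> (c *\<^sub>C a) = c *\<^sub>C l \<beta> a"
    and rC: "r (c *\<^sub>C a) \<beta> = c *\<^sub>C r a \<beta>" "r a (c *\<^sub>C \<beta>) = c *\<^sub>C r a \<beta>" for c a \<beta>
    using assms by (auto simp: banach_bimodule_def bounded_cbilinear_def)
  have f: "bounded_linear (dup_fst :: ('b, 'a) dup \<Rightarrow> 'b)"
    and s: "bounded_linear (dup_snd :: ('b, 'a) dup \<Rightarrow> 'a)"
    using bounded_clinear_dup_fst bounded_clinear_dup_snd by (auto simp: bounded_clinear_def)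
  obtain K where K: "\<And>\<beta> a. norm (l \<beta> a) \<le> norm \<beta> * norm a * K" "K \<ge> 0"
    using bounded_bilinear.nonneg_bounded[OF l] by blast
  obtain L where L: "\<And>a \<beta>. norm (r a \<beta>) \<le> norm a * norm \<beta> * L" "L \<ge> 0"
    using bounded_bilinear.nonneg_bounded[OF r] by blast
  have bound: "norm (dup_mult l r p q) \<le> norm p * norm q * (1 + L + K)" for p q
  proof -
    obtain a \<beta> b \<gamma> where p: "p = Dup a \<beta>" and q: "q = Dup b \<gamma>"
      by (cases p, cases q) auto
    have "norm (dup_mult l r p q) \<le>
        norm (a * b) + norm (r a \<gamma>) + norm (l \<beta> b) + norm (\<beta> * \<gamma>)"
      using norm_triangle_ineq[of "a * b + r a \<gamma>" "l \<beta> b"] norm_triangle_ineq[of "a * b" "r a \<gamma>"]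
      by (simp add: p q dup_mult_def norm_dup_def)
    also have "\<dots> \<le> norm a * norm b + norm a * norm \<gamma> * L + norm \<beta> * norm b * K + norm \<beta> * norm \<gamma>"
      by (intro add_mono norm_mult_ineq K L)
    also have "\<dots> \<le> (norm a + norm \<beta>) * (norm b + norm \<gamma>) * (1 + L + K)"
    proof -
      have "0 \<le> norm a * norm b * (L + K) + norm a * norm \<gamma> * (1 + K)
          + norm \<beta> * norm b * (1 + L) + norm \<beta> * norm \<gamma> * (L + K)"
        using K(2) L(2) by simp
      then show ?thesis by (simp add: algebra_simps)
    qed
    finally show ?thesis by (simp add: p q norm_dup_def)
  qed
  have "bounded_bilinear (dup_mult l r)"
  proof
    show "\<exists>K. \<forall>p q. norm (dup_mult l r p q) \<le> norm p * norm q * K" using bound by blast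
  qed (auto simp: dup_mult_def plus_dup_def scaleR_dup_def algebra_simps
      bounded_bilinear.add_left[OF l] bounded_bilinear.add_right[OF l]
      bounded_bilinear.add_left[OF r] bounded_bilinear.add_right[OF r]
      bounded_bilinear.scaleR_left[OF l] bounded_bilinear.scaleR_right[OF l]
      bounded_bilinear.scaleR_left[OF r] bounded_bilinear.scaleR_right[OF r])
  then show ?thesis
    by (auto simp: bounded_cbilinear_def dup_mult_def scaleC_dup_def lC rC
        mult_scaleC_left mult_scaleC_right scaleC_add_right)
qed

end

theory Submission
  imports Defs
begin

text \<open>
  Pairing a map into a dual with a third element turns the derivation law into an identity between
  scalars: \<open>D\<close> is a derivation into the dual of a bimodule exactly when
  \<open>\<langle>D (c d), x\<rangle> = \<langle>D c, d \<cdot> x\<rangle> + \<langle>D d, x \<cdot> c\<rangle>\<close>.  For \<open>D\<close> on the amalgamated duplication the difference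
  of the two sides is trilinear, so it vanishes identically if and only if it vanishes whenever each
  of the three arguments lies in one of the two summands.  This gives eight identities.  Those with
  all arguments in the same summand say that the diagonal components \<open>D1A\<close> and \<open>D2B\<close> of \<open>D\<close> are
  derivations.  When two arguments come from the acting algebra, the product is either that of the
  acting algebra, which gives the derivation law of \<open>D1B\<close>, or an action, which gives the rules for
  \<open>D2A\<close> on \<open>\<beta> \<cdot> a\<close> and \<open>a \<cdot> \<beta>\<close>; when only one does, the rules are those for \<open>D1A\<close> on \<open>\<beta> \<cdot> a\<close> and
  \<open>a \<cdot> \<beta>\<close> and the one for \<open>D2A\<close> on \<open>a b\<close>.

  The cyclicity condition is bilinear and splits in the same way: on the diagonal it is cyclicity of
  \<open>D1A\<close> and of \<open>D2B\<close>, and the mixed case \<open>\<langle>D2A a, \<beta>\<rangle> + \<langle>D1B \<beta>, a\<rangle> = 0\<close> says that \<open>D1B\<close> is minus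
  the adjoint of \<open>D2A\<close> after the canonical injection, by pairing with \<open>a\<close>.

  Every bounded \<open>D\<close> is made of four bounded components, obtained by restricting \<open>D\<close> to a summand and
  its values to a summand.  The equivalence of \<open>cyclic_derivation_dup_iff\<close> holds for any such
  decomposition, so both directions of the theorem follow from it.
\<close>

lemma bounded_clinear_simps:
  assumes "bounded_clinear f"
  shows "f (x + y) = f x + f y" "f 0 = 0"
  using assms linear_simps[of f] by (auto simp: bounded_clinear_def)

lemma bounded_cbilinear_simps:
  assumes "bounded_cbilinear p"
  shows "p 0 y = 0" "p x 0 = 0"
  using bounded_clinear_simps(2)[OF bounded_clinear_left[OF assms]]
    bounded_clinear_simps(2)[OF bounded_clinear_right[OF assms]]
  by auto

lemma derivation_dual_iff:
  assumes "bounded_cbilinear l" "bounded_cbilinear r"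
  shows "derivation m (dual_left r) (dual_right l) D \<longleftrightarrow> bounded_clinear D \<and>
    (\<forall>c d x. cdual_apply (D (m c d)) x = cdual_apply (D c) (l d x) + cdual_apply (D d) (r x c))"
  by (auto simp: derivation_def dual_left_apply[OF assms(2)] dual_right_apply[OF assms(1)]
      intro!: cdual_eqI)

lemma bounded_clinear_cadjoint:
  assumes "bounded_clinear T"
  shows "bounded_clinear (cadjoint T)"
proof -
  have T: "bounded_linear T" using assms by (simp add: bounded_clinear_def)
  have "bounded_linear (cadjoint T)"
  proof (rule bounded_linear_intro[where K = "onorm T"])
    fix f
    show "norm (cadjoint T f) \<le> norm f * onorm T"
    proof (rule norm_cdual_bound)
      fix x
      have "norm (cdual_apply f (T x)) \<le> norm f * (onorm T * norm x)"
        by (rule order_trans[OF norm_cdual_apply]) (intro mult_left_mono onorm[OF T] norm_ge_zero)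
      then show "norm (cdual_apply (cadjoint T f) x) \<le> norm f * onorm T * norm x"
        by (simp add: cadjoint_apply[OF assms] mult.assoc)
    qed (simp add: onorm_pos_le[OF T])
  qed (auto intro!: cdual_eqI simp: cadjoint_apply[OF assms])
  then show ?thesis
    by (auto simp: bounded_clinear_def cadjoint_apply[OF assms] intro!: cdual_eqI)
qed

lemma bounded_clinear_dup_inclusions:
  "bounded_clinear (\<lambda>a. Dup a 0 :: ('a::complex_normed_vector, 'b::complex_normed_vector) dup)"
  "bounded_clinear (\<lambda>\<beta>. Dup 0 \<beta> :: ('a, 'b) dup)"
proof -
  have zero: "c *\<^sub>C (0 :: 'x::complex_normed_vector) = 0" for c
    using norm_scaleC[of c "0 :: 'x"] by simp
  have "bounded_linear (\<lambda>a. Dup a 0 :: ('a, 'b) dup)"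
    "bounded_linear (\<lambda>\<beta>. Dup 0 \<beta> :: ('a, 'b) dup)"
    by (auto intro!: bounded_linear_intro[where K = 1]
        simp: plus_dup_def scaleR_dup_def norm_dup_def)
  then show "bounded_clinear (\<lambda>a. Dup a 0 :: ('a, 'b) dup)"
    "bounded_clinear (\<lambda>\<beta>. Dup 0 \<beta> :: ('a, 'b) dup)"
    by (auto simp: bounded_clinear_def scaleC_dup_def zero)
qed

text \<open>
  Functionals restrict to a summand through the adjoint of its inclusion; this is where the
  boundedness of the four components comes from.
\<close>

lemma bounded_clinear_into_dup_dual_components:
  fixes D :: "('a::complex_normed_vector, 'b::complex_normed_vector) dup \<Rightarrow> ('a, 'b) dup cdual"
  assumes D: "bounded_clinear D"
  obtains D1A D1B D2A D2B where
    "bounded_clinear D1A" "bounded_clinear D1B" "bounded_clinear D2A" "bounded_clinear D2B"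
    "\<And>a \<beta>. D (Dup a \<beta>) = dup_functional (D1A a + D1B \<beta>) (D2A a + D2B \<beta>)"
proof
  let ?i = "\<lambda>a. Dup a 0 :: ('a, 'b) dup" and ?j = "\<lambda>\<beta>. Dup 0 \<beta> :: ('a, 'b) dup"
  note incl = bounded_clinear_dup_inclusions
  note comp = bounded_clinear_compose[OF bounded_clinear_cadjoint bounded_clinear_compose[OF D]]
  show "bounded_clinear (\<lambda>a. cadjoint ?i (D (?i a)))" "bounded_clinear (\<lambda>\<beta>. cadjoint ?i (D (?j \<beta>)))"
    "bounded_clinear (\<lambda>a. cadjoint ?j (D (?i a)))" "bounded_clinear (\<lambda>\<beta>. cadjoint ?j (D (?j \<beta>)))"
    by (intro comp incl)+
  fix a \<beta>
  have split: "Dup x y = ?i x + ?j y" for x y by (simp add: plus_dup_def)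
  show "D (Dup a \<beta>) = dup_functional (cadjoint ?i (D (?i a)) + cadjoint ?i (D (?j \<beta>)))
      (cadjoint ?j (D (?i a)) + cadjoint ?j (D (?j \<beta>)))"
  proof (rule cdual_eqI)
    fix p :: "('a, 'b) dup"
    obtain c \<delta> where p: "p = Dup c \<delta>" by (cases p)
    have "D (Dup a \<beta>) = D (?i a) + D (?j \<beta>)"
      by (subst split) (rule bounded_clinear_simps(1)[OF D])
    moreover have "cdual_apply f p = cdual_apply f (?i c) + cdual_apply f (?j \<delta>)" for f
      unfolding p by (subst split) (rule bounded_clinear_simps(1)[OF bounded_clinear_cdual_apply])
    ultimately show "cdual_apply (D (Dup a \<beta>)) p =
        cdual_apply (dup_functional (cadjoint ?i (D (?i a)) + cadjoint ?i (D (?j \<beta>)))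
          (cadjoint ?j (D (?i a)) + cadjoint ?j (D (?j \<beta>)))) p"
      by (simp add: p dup_functional_apply cadjoint_apply incl
          bounded_clinear_simps(2)[OF bounded_clinear_cdual_apply] flip: zero_dup_def)
  qed
qed

text \<open>
  In the forward direction each of the eight identities is the trilinear law at arguments with one
  zero coordinate; conversely their sum is the law at arbitrary arguments.
\<close>

lemma cyclic_derivation_dup_iff:
  fixes l :: "'b::cbanach_algebra \<Rightarrow> 'a::cbanach_algebra \<Rightarrow> 'a"
    and r :: "'a \<Rightarrow> 'b \<Rightarrow> 'a"
    and D :: "('a, 'b) dup \<Rightarrow> ('a, 'b) dup cdual"
  assumes bimodule: "banach_bimodule (*) l r"
    and bounded: "bounded_clinear D" "bounded_clinear D1A" "bounded_clinear D1B"
      "bounded_clinear D2A" "bounded_clinear D2B"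
    and D: "\<And>a \<beta>. D (Dup a \<beta>) = dup_functional (D1A a + D1B \<beta>) (D2A a + D2B \<beta>)"
  shows "cyclic_derivation (dup_mult l r) D \<longleftrightarrow>
      cyclic_derivation (*) D1A \<and>
      cyclic_derivation (*) D2B \<and>
      derivation (*) (dual_left r) (dual_right l) D1B \<and>
      (\<forall>a \<beta>. D1A (l \<beta> a) = dual_right (*) (D1B \<beta>) a + dual_left r \<beta> (D1A a) \<and>
             D1A (r a \<beta>) = dual_left (*) a (D1B \<beta>) + dual_right l (D1A a) \<beta>) \<and>
      (\<forall>a \<beta>. D2A (l \<beta> a) = dual_right r (D1B \<beta>) a + dual_left (*) \<beta> (D2A a) \<and>
             D2A (r a \<beta>) = dual_left l a (D1B \<beta>) + dual_right (*) (D2A a) \<beta>) \<and>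
      (\<forall>a b. D2A (a * b) = dual_right r (D1A a) b + dual_left l a (D1A b)) \<and>
      (\<forall>\<beta>. (cadjoint D2A \<circ> canonical_injection) \<beta> + D1B \<beta> = 0)"
    (is "_ \<longleftrightarrow> ?R")
proof -
  let ?ap = cdual_apply
  have L: "bounded_cbilinear l" and R: "bounded_cbilinear r"
    using bimodule by (auto simp: banach_bimodule_def)
  note cbilin = L R bounded_cbilinear_mult
  note zero = bounded_clinear_simps(2)[OF bounded_clinear_cdual_apply]
    bounded_clinear_simps(2)[OF bounded(2)] bounded_clinear_simps(2)[OF bounded(3)]
    bounded_clinear_simps(2)[OF bounded(4)] bounded_clinear_simps(2)[OF bounded(5)]
    bounded_cbilinear_simps[OF L] bounded_cbilinear_simps[OF R]
  note add = bounded_clinear_simps(1)[OF bounded_clinear_cdual_apply]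
    bounded_clinear_simps(1)[OF bounded(2)] bounded_clinear_simps(1)[OF bounded(3)]
    bounded_clinear_simps(1)[OF bounded(4)] bounded_clinear_simps(1)[OF bounded(5)]
  have pair: "?ap (D (Dup a \<beta>)) (Dup c \<delta>) =
      ?ap (D1A a) c + ?ap (D1B \<beta>) c + (?ap (D2A a) \<delta> + ?ap (D2B \<beta>) \<delta>)" for a \<beta> c \<delta>
    by (simp add: D dup_functional_apply)

  have law: "derivation (dup_mult l r) (dual_left (dup_mult l r)) (dual_right (dup_mult l r)) D \<longleftrightarrow>
      (\<forall>p q t. ?ap (D (dup_mult l r p q)) t =
        ?ap (D p) (dup_mult l r q t) + ?ap (D q) (dup_mult l r t p))"
    using bounded(1) bounded_cbilinear_dup_mult[OF bimodule] by (simp add: derivation_dual_iff)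
  have cyc: "(\<forall>p q. ?ap (D p) q + ?ap (D q) p = 0) \<longleftrightarrow>
      (\<forall>a b. ?ap (D1A a) b + ?ap (D1A b) a = 0) \<and> (\<forall>\<beta> \<gamma>. ?ap (D2B \<beta>) \<gamma> + ?ap (D2B \<gamma>) \<beta> = 0) \<and>
      (\<forall>\<beta> a. ?ap (D2A a) \<beta> + ?ap (D1B \<beta>) a = 0)" (is "?C \<longleftrightarrow> ?C'")
  proof
    assume C: ?C
    have "?ap (D1A a) b + ?ap (D1A b) a = 0" "?ap (D2B \<beta>) \<gamma> + ?ap (D2B \<gamma>) \<beta> = 0"
      "?ap (D2A a) \<beta> + ?ap (D1B \<beta>) a = 0" for a b \<beta> \<gamma>
      using C[rule_format, of "Dup a 0" "Dup b 0"] C[rule_format, of "Dup 0 \<beta>" "Dup 0 \<gamma>"]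
        C[rule_format, of "Dup a 0" "Dup 0 \<beta>"]
      by (simp_all add: pair zero)
    then show ?C' by blast
  next
    assume C': ?C'
    show ?C
    proof (intro allI)
      fix p q :: "('a, 'b) dup"
      obtain a \<beta> b \<gamma> where pq: "p = Dup a \<beta>" "q = Dup b \<gamma>" by (cases p, cases q)
      have "?ap (D p) q + ?ap (D q) p =
          (?ap (D1A a) b + ?ap (D1A b) a) + (?ap (D2B \<beta>) \<gamma> + ?ap (D2B \<gamma>) \<beta>) +
          (?ap (D2A a) \<gamma> + ?ap (D1B \<gamma>) a) + (?ap (D2A b) \<beta> + ?ap (D1B \<beta>) b)"
        by (simp add: pq pair algebra_simps)
      then show "?ap (D p) q + ?ap (D q) p = 0" by (simp add: C')
    qed
  qed

  \<comment> \<open>The three letters tell which summands \<open>p\<close>, \<open>q\<close> and \<open>t\<close> of the trilinear law are taken from.\<close>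
  let ?AAA = "\<forall>a b c. ?ap (D1A (a * b)) c = ?ap (D1A a) (b * c) + ?ap (D1A b) (c * a)"
  let ?AAB = "\<forall>a b \<delta>. ?ap (D2A (a * b)) \<delta> = ?ap (D1A a) (r b \<delta>) + ?ap (D1A b) (l \<delta> a)"
  let ?BAA = "\<forall>a \<beta> c. ?ap (D1A (l \<beta> a)) c = ?ap (D1B \<beta>) (a * c) + ?ap (D1A a) (r c \<beta>)"
  let ?ABA = "\<forall>a \<beta> c. ?ap (D1A (r a \<beta>)) c = ?ap (D1B \<beta>) (c * a) + ?ap (D1A a) (l \<beta> c)"
  let ?BAB = "\<forall>a \<beta> \<delta>. ?ap (D2A (l \<beta> a)) \<delta> = ?ap (D1B \<beta>) (r a \<delta>) + ?ap (D2A a) (\<delta> * \<beta>)"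
  let ?ABB = "\<forall>a \<beta> \<delta>. ?ap (D2A (r a \<beta>)) \<delta> = ?ap (D1B \<beta>) (l \<delta> a) + ?ap (D2A a) (\<beta> * \<delta>)"
  let ?BBA = "\<forall>\<beta> \<gamma> c. ?ap (D1B (\<beta> * \<gamma>)) c = ?ap (D1B \<beta>) (l \<gamma> c) + ?ap (D1B \<gamma>) (r c \<beta>)"
  let ?BBB = "\<forall>\<beta> \<gamma> \<delta>. ?ap (D2B (\<beta> * \<gamma>)) \<delta> = ?ap (D2B \<beta>) (\<gamma> * \<delta>) + ?ap (D2B \<gamma>) (\<delta> * \<beta>)"
  have split: "(\<forall>p q t. ?ap (D (dup_mult l r p q)) t =
        ?ap (D p) (dup_mult l r q t) + ?ap (D q) (dup_mult l r t p)) \<longleftrightarrow>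
      ?AAA \<and> ?AAB \<and> ?BAA \<and> ?ABA \<and> ?BAB \<and> ?ABB \<and> ?BBA \<and> ?BBB" (is "?T \<longleftrightarrow> ?T'")
  proof
    assume T: ?T
    show ?T'
    proof (intro conjI allI)
      fix a b c :: 'a and \<beta> \<gamma> \<delta> :: 'b
      note eval = T[unfolded dup_mult_def, rule_format]
      show "?ap (D1A (a * b)) c = ?ap (D1A a) (b * c) + ?ap (D1A b) (c * a)"
        using eval[of "Dup a 0" "Dup b 0" "Dup c 0"] by (simp add: pair zero)
      show "?ap (D2A (a * b)) \<delta> = ?ap (D1A a) (r b \<delta>) + ?ap (D1A b) (l \<delta> a)"
        using eval[of "Dup a 0" "Dup b 0" "Dup 0 \<delta>"] by (simp add: pair zero)
      show "?ap (D1A (l \<beta> a)) c = ?ap (D1B \<beta>) (a * c) + ?ap (D1A a) (r c \<beta>)"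
        using eval[of "Dup 0 \<beta>" "Dup a 0" "Dup c 0"] by (simp add: pair zero)
      show "?ap (D1A (r a \<beta>)) c = ?ap (D1B \<beta>) (c * a) + ?ap (D1A a) (l \<beta> c)"
        using eval[of "Dup a 0" "Dup 0 \<beta>" "Dup c 0"] by (simp add: pair zero)
      show "?ap (D2A (l \<beta> a)) \<delta> = ?ap (D1B \<beta>) (r a \<delta>) + ?ap (D2A a) (\<delta> * \<beta>)"
        using eval[of "Dup 0 \<beta>" "Dup a 0" "Dup 0 \<delta>"] by (simp add: pair zero)
      show "?ap (D2A (r a \<beta>)) \<delta> = ?ap (D1B \<beta>) (l \<delta> a) + ?ap (D2A a) (\<beta> * \<delta>)"
        using eval[of "Dup a 0" "Dup 0 \<beta>" "Dup 0 \<delta>"] by (simp add: pair zero)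
      show "?ap (D1B (\<beta> * \<gamma>)) c = ?ap (D1B \<beta>) (l \<gamma> c) + ?ap (D1B \<gamma>) (r c \<beta>)"
        using eval[of "Dup 0 \<beta>" "Dup 0 \<gamma>" "Dup c 0"] by (simp add: pair zero)
      show "?ap (D2B (\<beta> * \<gamma>)) \<delta> = ?ap (D2B \<beta>) (\<gamma> * \<delta>) + ?ap (D2B \<gamma>) (\<delta> * \<beta>)"
        using eval[of "Dup 0 \<beta>" "Dup 0 \<gamma>" "Dup 0 \<delta>"] by (simp add: pair zero)
    qed
  next
    assume T': ?T'
    show ?T
    proof (intro allI)
      fix p q t :: "('a, 'b) dup"
      obtain a \<beta> b \<gamma> c \<delta> where "p = Dup a \<beta>" "q = Dup b \<gamma>" "t = Dup c \<delta>"
        by (cases p, cases q, cases t)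
      with T' show "?ap (D (dup_mult l r p q)) t =
          ?ap (D p) (dup_mult l r q t) + ?ap (D q) (dup_mult l r t p)"
        by (simp add: dup_mult_def pair add)
    qed
  qed

  have eqI: "f = g \<longleftrightarrow> (\<forall>x. ?ap f x = ?ap g x)" for f g :: "'x::complex_normed_vector cdual"
    by (auto intro: cdual_eqI)
  have "?R \<longleftrightarrow>
      (?AAA \<and> ?AAB \<and> ?BAA \<and> ?ABA \<and> ?BAB \<and> ?ABB \<and> ?BBA \<and> ?BBB) \<and>
      (\<forall>a b. ?ap (D1A a) b + ?ap (D1A b) a = 0) \<and> (\<forall>\<beta> \<gamma>. ?ap (D2B \<beta>) \<gamma> + ?ap (D2B \<gamma>) \<beta> = 0) \<and>
      (\<forall>\<beta> a. ?ap (D2A a) \<beta> + ?ap (D1B \<beta>) a = 0)"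
    unfolding cyclic_derivation_def derivation_dual_iff[OF L R]
      derivation_dual_iff[OF bounded_cbilinear_mult bounded_cbilinear_mult] eqI
    by (simp add: bounded dual_left_apply dual_right_apply cbilin cadjoint_apply
        canonical_injection_apply all_conj_distrib conj_ac)
  then show ?thesis
    unfolding cyclic_derivation_def[of "dup_mult l r"] law split cyc by (rule sym)
qed

theorem proposition4p4:
  fixes l :: "'b::cbanach_algebra \<Rightarrow> 'a::cbanach_algebra \<Rightarrow> 'a"
    and r :: "'a \<Rightarrow> 'b \<Rightarrow> 'a"
    and D :: "('a, 'b) dup \<Rightarrow> ('a, 'b) dup cdual"
  assumes "banach_bimodule (*) l r"
    and "compatible_actions l r"
    and "bounded_clinear D"
  shows "cyclic_derivation (dup_mult l r) D \<longleftrightarrow>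
    (\<exists>(D1A :: 'a \<Rightarrow> 'a cdual) (D2B :: 'b \<Rightarrow> 'b cdual) (D1B :: 'b \<Rightarrow> 'a cdual) (D2A :: 'a \<Rightarrow> 'b cdual).
      cyclic_derivation (*) D1A \<and>
      cyclic_derivation (*) D2B \<and>
      derivation (*) (dual_left r) (dual_right l) D1B \<and>
      bounded_clinear D2A \<and>
      (\<forall>a \<beta>. D (Dup a \<beta>) = dup_functional (D1A a + D1B \<beta>) (D2A a + D2B \<beta>)) \<and>
      (\<forall>a \<beta>. D1A (l \<beta> a) = dual_right (*) (D1B \<beta>) a + dual_left r \<beta> (D1A a) \<and>
             D1A (r a \<beta>) = dual_left (*) a (D1B \<beta>) + dual_right l (D1A a) \<beta>) \<and>
      (\<forall>a \<beta>. D2A (l \<beta> a) = dual_right r (D1B \<beta>) a + dual_left (*) \<beta> (D2A a) \<and>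
             D2A (r a \<beta>) = dual_left l a (D1B \<beta>) + dual_right (*) (D2A a) \<beta>) \<and>
      (\<forall>a b. D2A (a * b) = dual_right r (D1A a) b + dual_left l a (D1A b)) \<and>
      (\<forall>\<beta>. (cadjoint D2A \<circ> canonical_injection) \<beta> + D1B \<beta> = 0))"
    (is "_ \<longleftrightarrow> ?R" is "_ \<longleftrightarrow> (\<exists>D1A D2B D1B D2A. ?P D1A D2B D1B D2A)")
proof
  assume cyclic: "cyclic_derivation (dup_mult l r) D"
  obtain D1A D1B D2A D2B where
    bounded: "bounded_clinear D1A" "bounded_clinear D1B" "bounded_clinear D2A" "bounded_clinear D2B"
    and D: "\<And>a \<beta>. D (Dup a \<beta>) = dup_functional (D1A a + D1B \<beta>) (D2A a + D2B \<beta>)"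
    using bounded_clinear_into_dup_dual_components[OF assms(3)] by blast
  note cyclic_derivation_dup_iff[OF assms(1,3) bounded D, THEN iffD1, OF cyclic]
  with bounded(3) D show ?R by blast
next
  assume ?R
  then obtain D1A D2B D1B D2A where R: "?P D1A D2B D1B D2A" by blast
  then have bounded: "bounded_clinear D1A" "bounded_clinear D1B" "bounded_clinear D2A"
      "bounded_clinear D2B"
    and D: "\<And>a \<beta>. D (Dup a \<beta>) = dup_functional (D1A a + D1B \<beta>) (D2A a + D2B \<beta>)"
    by (auto simp: cyclic_derivation_def derivation_def)
  show "cyclic_derivation (dup_mult l r) D"
    using R by (subst cyclic_derivation_dup_iff[OF assms(1,3) bounded D]) blast
qed

end
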